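(* Let $n\ge 2$ be an integer and let $(R_k)_{k\in\mathbb Z}$ be a sequence of real numbers with $R_1=1$ satisfying the following. (Recurrence) $R_2\,R_k=R_{k+1}+R_{k-1}$ for all integers $k\ge 0$. (Rule i) $R_{-|k|}=-R_{|k|}$ for all $k\in\mathbb Z$ (so in particular $R_0=0$). (Rule ii) $R_k=R_{n-k}$ for all $k\in\{\lfloor n/2\rfloor+1,\dots,n\}$. Then for all integers $m\ge 2$ and $k\ge 2$, $$R_m\,R_k=\sum_{j=0}^{k-1}R_{m+k-(2j+1)} .$$
   Context: The motivating sequence is that of the diagonal/side ratios of the regular $n$-gon, $R_k=R^{(n)}_k=\sin(\pi k/n)/\sin(\pi/n)=S(k-1,2\cos(\pi/n))$, where $S(k,x)=U_k(x/2)$ and $U_k$ is the Chebyshev polynomial of the second kind. This sequence satisfies $R_1=1$, the recurrence, and both rules. *)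

theory Defs imports Complex_Main begin

end

theory Submission imports Defs begin

text \<open>The recurrence is that of the Chebyshev polynomials U, and the formula is their product
  expansion. For fixed m, both sides are sequences in k with the same second-order recurrence:
  multiplying a sum of terms R_i by R_2 replaces each R_i by its two neighbours, and almost all the
  lower neighbours make up the sum for the preceding k. Two-step induction from k = 0, 1 therefore
  suffices (\<open>chebyshev_product_sum\<close>), provided the recurrence holds at every integer;
  oddness of R supplies it at negative indices.\<close>

lemma chebyshev_product_sum:
  fixes R :: "int \<Rightarrow> 'a::comm_ring_1"
  assumes R0: "R 0 = 0" and R1: "R 1 = 1"
    and rec: "\<And>k. R 2 * R k = R (k + 1) + R (k - 1)"
  shows "R m * R (int k) = (\<Sum>j<k. R (m + int k - (2 * int j + 1)))"
proof (induction k rule: induct_nat_012)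
  case (ge2 k)
  \<comment> \<open>\<open>f j\<close> and \<open>g j\<close> sit just below and just above index m
    + k - 2j, that of the j-th term in the sum for \<open>Suc k\<close>.\<close>
  define f where "f j = R (m + int k - (2 * int j + 1))" for j
  define g where "g j = R (m + int k + 1 - 2 * int j)" for j
  have S0: "R m * R (int k) = (\<Sum>j<k. f j)"
    using ge2.IH(1) by (simp add: f_def)
  have S1: "R m * R (int (Suc k)) = (\<Sum>j<Suc k. R (m + int k - 2 * int j))"
    unfolding ge2.IH(2) by (rule sum.cong) (simp_all add: algebra_simps)
  have "R 2 * R (m + int k - 2 * int j) = g j + f j" for j
    using rec[of "m + int k - 2 * int j"] by (simp add: f_def g_def algebra_simps)
  then have step: "R 2 * (R m * R (int (Suc k))) = (\<Sum>j<Suc k. g j) + (\<Sum>j<Suc k. f j)"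
    unfolding S1 by (simp only: sum_distrib_left sum.distrib)
  have "R (int (Suc (Suc k))) = R 2 * R (int (Suc k)) - R (int k)"
    using rec[of "int (Suc k)"] by (simp add: algebra_simps)
  then have "R m * R (int (Suc (Suc k))) = R 2 * (R m * R (int (Suc k))) - R m * R (int k)"
    by (simp only: right_diff_distrib mult.left_commute)
  \<comment> \<open>Subtracting the sum for \<open>k\<close> cancels every lower neighbour except
    the last.\<close>
  also have "\<dots> = (\<Sum>j<Suc k. g j) + f k"
    unfolding step S0 by simp
  \<comment> \<open>Both are R at m - k - 1, so the leftover is exactly the last term missing from
    the new sum.\<close>
  also have "f k = g (Suc k)"
    by (simp add: f_def g_def algebra_simps)
  also have "(\<Sum>j<Suc k. g j) + g (Suc k) = (\<Sum>j<Suc (Suc k). g j)"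
    by simp
  also have "\<dots> = (\<Sum>j<Suc (Suc k). R (m + int (Suc (Suc k)) - (2 * int j + 1)))"
    by (rule sum.cong) (simp_all add: g_def algebra_simps)
  finally show ?case .
qed (simp_all add: R0 R1)

theorem proposition1:
  fixes n :: int and R :: "int \<Rightarrow> real"
  assumes n: "n \<ge> 2"
    and R_1: "R 1 = 1"
    and recurrence: "\<And>k. k \<ge> 0 \<Longrightarrow> R 2 * R k = R (k + 1) + R (k - 1)"
    and rule_i: "\<And>k. R (- \<bar>k\<bar>) = - R \<bar>k\<bar>"
    and rule_ii: "\<And>k. k \<in> {\<lfloor>real_of_int n / 2\<rfloor> + 1..n} \<Longrightarrow> R k = R (n - k)"
  shows "\<forall>m\<ge>2. \<forall>k\<ge>2. R m * R k = (\<Sum>j = 0..k - 1. R (m + k - (2 * j + 1)))"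
proof (intro allI impI)
  fix m k :: int assume k: "k \<ge> 2"
  have odd: "R (- i) = - R i" for i
    using rule_i[of i] by (cases "i \<ge> 0") simp_all
  \<comment> \<open>The induction uses the recurrence at indices down to m - k, which can be
    negative. For negative i, oddness turns the recurrence at -i into the one at i, with the two
    neighbours swapped.\<close>
  have rec: "R 2 * R i = R (i + 1) + R (i - 1)" for i
  proof (cases "i \<ge> 0")
    case False
    have "R (- i + 1) = - R (i - 1)" "R (- i - 1) = - R (i + 1)"
      using odd[of "i - 1"] odd[of "i + 1"] by simp_all
    then show ?thesis
      using False recurrence[of "- i"] odd[of i] by simp
  qed (rule recurrence)
  have "R 0 = 0"
    using odd[of 0] by simp
  then have "R m * R (int (nat k)) = (\<Sum>j<nat k. R (m + int (nat k) - (2 * int j + 1)))"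
    using R_1 rec by (rule chebyshev_product_sum)
  also have "\<dots> = (\<Sum>j = 0..k - 1. R (m + k - (2 * j + 1)))"
    using k by (intro sum.reindex_bij_witness[of _ nat int]) auto
  finally show "R m * R k = (\<Sum>j = 0..k - 1. R (m + k - (2 * j + 1)))"
    using k by simp
qed

end
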